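(* Let $\mathfrak{E}$ be the steering ellipsoid of a two-qubit X state, and let $\overline{S}_{\leftrightarrow}(z)$, $z\in[z_H,z_G]$, be its horizontal average entropy. If $\overline{S}_{\leftrightarrow}(z)$ is a convex function for $z\in[z_H,z_G]$, then $\mathfrak{E}$ is of type $\mathfrak{E}_{\leftrightarrow}$: for all X states whose steering ellipsoid is $\mathfrak{E}$, the optimal decomposition of $\rho^B$ is the horizontal one. If $\overline{S}_{\leftrightarrow}(z)$ is a concave function for $z\in[z_H,z_G]$, then $\mathfrak{E}$ is of type $\mathfrak{E}_{\updownarrow}$: for all X states whose steering ellipsoid is $\mathfrak{E}$, the optimal decomposition of $\rho^B$ is the vertical one.
   Context: An X state (up to local unitaries) is a two-qubit density matrix, in the product basis $|00\rangle,|01\rangle,|10\rangle,|11\rangle$ (first factor $A$, second factor $B$), $$\rho^{AB}=\begin{pmatrix} a & 0 & 0 & u \\ 0 & b & v & 0 \\ 0 & v & c & 0 \\ u & 0 & 0 & d \end{pmatrix},$$ with $a,b,c,d\ge 0$, $a+b+c+d=1$, $u,v\ge 0$, $u^2\le ad$, $v^2\le bc$, and $(a+b)(c+d)>0$ so that the following quantities are defined: $$\ell_1=\tfrac{u+v}{\sqrt{(a+b)(c+d)}},\quad \ell_2=\tfrac{|u-v|}{\sqrt{(a+b)(c+d)}},\quad \ell_3=\tfrac{|ad-bc|}{(a+b)(c+d)},\quad z_0=\tfrac{ac-bd}{(a+b)(c+d)}.$$ The steering ellipsoid $\mathfrak{E}$ is the ellipsoid in $\mathbb{R}^3$ with surface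 $x^2/\ell_1^2+y^2/\ell_2^2+(z-z_0)^2/\ell_3^2=1$; it lies in the closed unit ball. Degenerate cases ($u=v$ or $ad=bc$, where it becomes an ellipse or a line segment) are allowed; then the surface is read as $\{(\ell_1n_1,\ell_2n_2,z_0+\ell_3n_3): n_1^2+n_2^2+n_3^2=1\}$. The ellipse $\mathbf{E}$ is the curve $x^2/\ell_1^2+(z-z_0)^2/\ell_3^2=1$ in the $x$-$z$ plane (in degenerate cases $\{(\ell_1 n_1,z_0+\ell_3 n_3): n_1^2+n_3^2=1\}$). Put $z_G=z_0+\ell_3$, $z_H=z_0-\ell_3$; $G=(0,z_G)$ and $H=(0,z_H)$ are the upper and lower vertices of $\mathbf{E}$. The reduced state $\rho^B$ has Bloch vector $B=(0,0,z_B)$ with $z_B=a-b+c-d$. Let $h(x)=-\frac{1+x}{2}\log_2\frac{1+x}{2}-\frac{1-x}{2}\log_2\frac{1-x}{2}$ for $x\in[0,1]$ (with $0\log_2 0=0$). A point $X$ at distance $|OX|$ from the origin represents a qubit state with von Neumann entropy $S_X=h(|OX|)$. A decomposition of $\rho^B$ is an expression of $B$ as a finite convex combination $B=\sum_ip_iB_i$ of points $B_i$ on the surface of $\mathfrak{E}$ (these are the post-measurement ensembles of qubit $B$ obtained from rank-1 POVMs on $A$). Its average entropy is $\sum_ip_iS_{B_i}$. A decomposition is optimal if it attains the minimum of the average entropy over all decompositions of $\rho^B$. The horizontal decomposition of the state at the point $(0,z)$ of the $x$-$z$ plane, $z\in[z_H,z_G]$, is the one, with weights $\frac12,\frac12$,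 into the two end points of the horizontal chord of $\mathbf{E}$ (parallel to the $x$ axis) through $(0,z)$; for $\rho^B$ take $z=z_B$. The vertical decomposition of $\rho^B$ is the one into $G$ and $H$. The horizontal average entropy $\overline{S}_{\leftrightarrow}(z)$ is the average entropy of the horizontal decomposition of the state at $(0,z)$, that is, $\overline{S}_{\leftrightarrow}(z)=h(r(z))$, $z\in[z_H,z_G]$, with $r(z)=\big[z^2+\ell_1^2\big(1-(z-z_0)^2/\ell_3^2\big)\big]^{1/2}$ (if $\ell_3=0$, the interval is the single point $z_0$ and the chord has end points $(\pm\ell_1,z_0)$). Type $\mathfrak{E}_{\leftrightarrow}$ (respectively $\mathfrak{E}_{\updownarrow}$) means that the horizontal (respectively vertical) decomposition of $\rho^B$ is optimal for every X state having $\mathfrak{E}$ as its steering ellipsoid.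
   Formalization: The concave claim excludes ellipsoids with ℓ3 = 0 and ℓ1 > 0; there [z_H,z_G] is one point, so concavity is automatic, but the vertical decomposition is never optimal (e.g. a=b=c=d=u=v=1/4: vertical entropy 1, horizontal 0). *)

theory Defs
  imports "HOL-Analysis.Analysis"
begin

section \<open>X states\<close>

text \<open>Rows and columns 1, 2, 3, 4 stand for the product basis vectors 00, 01, 10, 11 (first
  factor A). The phases of the two antidiagonal entries have been removed by local unitaries,
  so all entries are real.\<close>

definition x_matrix :: "real \<Rightarrow> real \<Rightarrow> real \<Rightarrow> real \<Rightarrow> real \<Rightarrow> real \<Rightarrow> real^4^4" where
  "x_matrix a b c d u v = vector
     [vector [a, 0, 0, u],
      vector [0, b, v, 0],
      vector [0, v, c, 0],
      vector [u, 0, 0, d]]"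

definition X_state :: "real^4^4 \<Rightarrow> bool" where
  "X_state \<rho> \<longleftrightarrow> (\<exists>a b c d u v. \<rho> = x_matrix a b c d u v \<and>
     a \<ge> 0 \<and> b \<ge> 0 \<and> c \<ge> 0 \<and> d \<ge> 0 \<and> a + b + c + d = 1 \<and> u \<ge> 0 \<and> v \<ge> 0 \<and>
     u\<^sup>2 \<le> a * d \<and> v\<^sup>2 \<le> b * c \<and> (a + b) * (c + d) > 0)"

definition ent_a :: "real^4^4 \<Rightarrow> real" where "ent_a \<rho> = \<rho> $ 1 $ 1"
definition ent_b :: "real^4^4 \<Rightarrow> real" where "ent_b \<rho> = \<rho> $ 2 $ 2"
definition ent_c :: "real^4^4 \<Rightarrow> real" where "ent_c \<rho> = \<rho> $ 3 $ 3"
definition ent_d :: "real^4^4 \<Rightarrow> real" where "ent_d \<rho> = \<rho> $ 4 $ 4"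
definition ent_u :: "real^4^4 \<Rightarrow> real" where "ent_u \<rho> = \<rho> $ 1 $ 4"
definition ent_v :: "real^4^4 \<Rightarrow> real" where "ent_v \<rho> = \<rho> $ 2 $ 3"

lemma ent_x_matrix [simp]:
  "ent_a (x_matrix a b c d u v) = a" "ent_b (x_matrix a b c d u v) = b"
  "ent_c (x_matrix a b c d u v) = c" "ent_d (x_matrix a b c d u v) = d"
  "ent_u (x_matrix a b c d u v) = u" "ent_v (x_matrix a b c d u v) = v"
  by (simp_all add: x_matrix_def vector_def
      ent_a_def ent_b_def ent_c_def ent_d_def ent_u_def ent_v_def)

section \<open>The steering ellipsoid\<close>

text \<open>\<open>pA\<close> is the product of the two diagonal entries of the reduced state of A.\<close>

definition pA :: "real^4^4 \<Rightarrow> real" where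
  "pA \<rho> = (ent_a \<rho> + ent_b \<rho>) * (ent_c \<rho> + ent_d \<rho>)"

definition ell1 :: "real^4^4 \<Rightarrow> real" where
  "ell1 \<rho> = (ent_u \<rho> + ent_v \<rho>) / sqrt (pA \<rho>)"

definition ell2 :: "real^4^4 \<Rightarrow> real" where
  "ell2 \<rho> = \<bar>ent_u \<rho> - ent_v \<rho>\<bar> / sqrt (pA \<rho>)"

definition ell3 :: "real^4^4 \<Rightarrow> real" where
  "ell3 \<rho> = \<bar>ent_a \<rho> * ent_d \<rho> - ent_b \<rho> * ent_c \<rho>\<bar> / pA \<rho>"

definition z0 :: "real^4^4 \<Rightarrow> real" where
  "z0 \<rho> = (ent_a \<rho> * ent_c \<rho> - ent_b \<rho> * ent_d \<rho>) / pA \<rho>"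

definition zG :: "real^4^4 \<Rightarrow> real" where "zG \<rho> = z0 \<rho> + ell3 \<rho>"
definition zH :: "real^4^4 \<Rightarrow> real" where "zH \<rho> = z0 \<rho> - ell3 \<rho>"
definition zB :: "real^4^4 \<Rightarrow> real" where
  "zB \<rho> = ent_a \<rho> - ent_b \<rho> + ent_c \<rho> - ent_d \<rho>"

definition bloch_B :: "real^4^4 \<Rightarrow> real^3" where
  "bloch_B \<rho> = vector [0, 0, zB \<rho>]"

text \<open>The ellipsoid is represented by its surface, which determines it, also when some
  semiaxes vanish. The parametrization below covers the degenerate cases; otherwise it is the
  surface given by the usual equation.\<close>

definition steering_ellipsoid :: "real^4^4 \<Rightarrow> (real^3) set" where
  "steering_ellipsoid \<rho> =
     {vector [ell1 \<rho> * n1, ell2 \<rho> * n2, z0 \<rho> + ell3 \<rho> * n3] | n1 n2 n3.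
        n1\<^sup>2 + n2\<^sup>2 + n3\<^sup>2 = 1}"

lemma steering_ellipsoid_nondegenerate:
  assumes "ell1 \<rho> \<noteq> 0" "ell2 \<rho> \<noteq> 0" "ell3 \<rho> \<noteq> 0"
  shows "steering_ellipsoid \<rho> =
    {X. (X$1)\<^sup>2 / (ell1 \<rho>)\<^sup>2 + (X$2)\<^sup>2 / (ell2 \<rho>)\<^sup>2 + (X$3 - z0 \<rho>)\<^sup>2 / (ell3 \<rho>)\<^sup>2 = 1}"
proof (intro set_eqI iffI)
  fix X :: "real^3"
  assume "X \<in> steering_ellipsoid \<rho>"
  then show "X \<in> {X. (X$1)\<^sup>2 / (ell1 \<rho>)\<^sup>2 + (X$2)\<^sup>2 / (ell2 \<rho>)\<^sup>2
      + (X$3 - z0 \<rho>)\<^sup>2 / (ell3 \<rho>)\<^sup>2 = 1}"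
    using assms by (auto simp: steering_ellipsoid_def power_mult_distrib)
next
  fix X :: "real^3"
  assume X: "X \<in> {X. (X$1)\<^sup>2 / (ell1 \<rho>)\<^sup>2 + (X$2)\<^sup>2 / (ell2 \<rho>)\<^sup>2
      + (X$3 - z0 \<rho>)\<^sup>2 / (ell3 \<rho>)\<^sup>2 = 1}"
  define n1 n2 n3 where
    "n1 = X$1 / ell1 \<rho>" and "n2 = X$2 / ell2 \<rho>" and "n3 = (X$3 - z0 \<rho>) / ell3 \<rho>"
  have "n1\<^sup>2 + n2\<^sup>2 + n3\<^sup>2 = 1"
    using X by (simp add: n1_def n2_def n3_def power_divide)
  moreover have "X = vector [ell1 \<rho> * n1, ell2 \<rho> * n2, z0 \<rho> + ell3 \<rho> * n3]"
    using assms by (simp add: vec_eq_iff forall_3 n1_def n2_def n3_def)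
  ultimately show "X \<in> steering_ellipsoid \<rho>"
    unfolding steering_ellipsoid_def by blast
qed

section \<open>Decompositions and average entropy\<close>

text \<open>The convention \<open>0 * log 2 0 = 0\<close> holds automatically.\<close>

definition h :: "real \<Rightarrow> real" where
  "h x = - ((1 + x) / 2) * log 2 ((1 + x) / 2) - ((1 - x) / 2) * log 2 ((1 - x) / 2)"

definition entropy_at :: "real^3 \<Rightarrow> real" where
  "entropy_at X = h (norm X)"

text \<open>A finite ensemble is a list of pairs (weight, Bloch vector).\<close>

definition avg_entropy :: "(real \<times> (real^3)) list \<Rightarrow> real" where
  "avg_entropy D = (\<Sum>(p, X)\<leftarrow>D. p * entropy_at X)"

definition decomposition :: "real^4^4 \<Rightarrow> (real \<times> (real^3)) list \<Rightarrow> bool" where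
  "decomposition \<rho> D \<longleftrightarrow>
     (\<forall>(p, X) \<in> set D. p \<ge> 0 \<and> X \<in> steering_ellipsoid \<rho>) \<and>
     (\<Sum>(p, X)\<leftarrow>D. p) = 1 \<and> (\<Sum>(p, X)\<leftarrow>D. p *\<^sub>R X) = bloch_B \<rho>"

definition optimal :: "real^4^4 \<Rightarrow> (real \<times> (real^3)) list \<Rightarrow> bool" where
  "optimal \<rho> D \<longleftrightarrow>
     decomposition \<rho> D \<and> (\<forall>D'. decomposition \<rho> D' \<longrightarrow> avg_entropy D \<le> avg_entropy D')"

text \<open>Half the length of the horizontal chord at height \<open>z\<close>. If \<open>ell3 \<rho> = 0\<close> then division by
  zero yields the value \<open>ell1 \<rho>\<close>, as it should be for the only height \<open>z = z0 \<rho>\<close>.\<close>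

definition half_chord :: "real^4^4 \<Rightarrow> real \<Rightarrow> real" where
  "half_chord \<rho> z = ell1 \<rho> * sqrt (1 - (z - z0 \<rho>)\<^sup>2 / (ell3 \<rho>)\<^sup>2)"

definition horizontal_decomp :: "real^4^4 \<Rightarrow> real \<Rightarrow> (real \<times> (real^3)) list" where
  "horizontal_decomp \<rho> z =
     [(1/2, vector [half_chord \<rho> z, 0, z]), (1/2, vector [- half_chord \<rho> z, 0, z])]"

definition horizontal_avg_entropy :: "real^4^4 \<Rightarrow> real \<Rightarrow> real" where
  "horizontal_avg_entropy \<rho> z = avg_entropy (horizontal_decomp \<rho> z)"

lemma horizontal_avg_entropy_eq:
  assumes "z \<in> {zH \<rho>..zG \<rho>}"
  shows "horizontal_avg_entropy \<rho> z =
    h (sqrt (z\<^sup>2 + (ell1 \<rho>)\<^sup>2 * (1 - (z - z0 \<rho>)\<^sup>2 / (ell3 \<rho>)\<^sup>2)))"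
proof -
  have "\<bar>z - z0 \<rho>\<bar> \<le> \<bar>ell3 \<rho>\<bar>"
    using assms by (auto simp: zH_def zG_def)
  then have "(z - z0 \<rho>)\<^sup>2 \<le> (ell3 \<rho>)\<^sup>2"
    by (simp add: abs_le_square_iff)
  then have "(z - z0 \<rho>)\<^sup>2 / (ell3 \<rho>)\<^sup>2 \<le> 1"
    by (simp add: divide_le_eq_1)
  then show ?thesis
    by (simp add: horizontal_avg_entropy_def avg_entropy_def horizontal_decomp_def entropy_at_def
        half_chord_def norm_vec_def L2_set_def sum_3 power_mult_distrib add.commute)
qed

text \<open>The weight \<open>wG\<close> of the upper vertex is forced by the barycentre when \<open>zH \<rho> < zG \<rho>\<close>; if
  \<open>zH \<rho> = zG \<rho>\<close> the two points coincide and the weights are immaterial.\<close>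

definition vertical_decomp :: "real^4^4 \<Rightarrow> (real \<times> (real^3)) list" where
  "vertical_decomp \<rho> =
     (let wG = (zB \<rho> - zH \<rho>) / (zG \<rho> - zH \<rho>)
      in [(wG, vector [0, 0, zG \<rho>]), (1 - wG, vector [0, 0, zH \<rho>])])"

section \<open>Types of ellipsoids\<close>

definition type_horizontal :: "(real^3) set \<Rightarrow> bool" where
  "type_horizontal E \<longleftrightarrow> (\<forall>\<rho>. X_state \<rho> \<longrightarrow> steering_ellipsoid \<rho> = E \<longrightarrow>
     optimal \<rho> (horizontal_decomp \<rho> (zB \<rho>)))"

text \<open>Pitfall: if \<open>ell3 \<rho> = 0\<close> and \<open>ell1 \<rho> > 0\<close>, then \<open>{zH \<rho>..zG \<rho>}\<close> is a single point, on which every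
  function is both convex and concave, whereas the vertical decomposition is the trivial
  ensemble at the centre of a horizontal disc or segment and is not optimal. Such an ellipsoid
  is never of the following type.\<close>

definition type_vertical :: "(real^3) set \<Rightarrow> bool" where
  "type_vertical E \<longleftrightarrow> (\<forall>\<rho>. X_state \<rho> \<longrightarrow> steering_ellipsoid \<rho> = E \<longrightarrow>
     optimal \<rho> (vertical_decomp \<rho>))"

end

theory Submission
  imports Defs
begin

text \<open>Since \<open>ell2 \<le> ell1\<close>, among all points of the ellipsoid at height \<open>z\<close> the ends of the horizontal
  chord are farthest from the origin, so by monotonicity of \<open>h\<close> every point at height \<open>z\<close> has entropy
  at least \<open>horizontal_avg_entropy \<rho> z\<close>. The average entropy of a decomposition is therefore bounded
  below by the corresponding average of \<open>horizontal_avg_entropy \<rho>\<close> over heights with mean \<open>zB \<rho>\<close>;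
  Jensen's inequality (convex case) or the chord through the two vertices (concave case)
  finishes the proof.\<close>

section \<open>Monotonicity of the binary entropy\<close>

lemma DERIV_mult_log:
  fixes t :: real
  assumes "0 < t"
  shows "DERIV (\<lambda>t. t * log 2 t) t :> log 2 t + 1 / ln 2"
  using assms by (auto intro!: derivative_eq_intros simp: log_def add_divide_distrib)

text \<open>For \<open>0 \<le> t < 1\<close> the derivative of \<open>h\<close> is half of
  \<open>log 2 ((1 - t) / 2) - log 2 ((1 + t) / 2)\<close>, hence nonpositive. This formula diverges
  at 1, so \<open>y = 1\<close> is treated apart: there \<open>h 1 = 0\<close>, while both summands
  of \<open>h x\<close> are nonnegative.\<close>

lemma h_antimono:
  assumes "0 \<le> x" "x \<le> y" "y \<le> 1"
  shows "h y \<le> h x"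
proof (cases "y = 1")
  case True
  have "(1 + x) / 2 * log 2 ((1 + x) / 2) \<le> 0" "(1 - x) / 2 * log 2 ((1 - x) / 2) \<le> 0"
    using assms by (cases "x = 1"; auto simp: mult_nonneg_nonpos log_le_zero_cancel_iff)+
  then show ?thesis
    using True by (simp add: h_def)
next
  case False
  show ?thesis
  proof (rule DERIV_nonpos_imp_nonincreasing[OF assms(2)])
    fix t assume "x \<le> t" "t \<le> y"
    then have t: "0 \<le> t" "t < 1"
      using assms False by auto
    have "DERIV (\<lambda>t. (1 + t) / 2 * log 2 ((1 + t) / 2)) t :>
        (log 2 ((1 + t) / 2) + 1 / ln 2) * (1 / 2)"
      using t by (intro DERIV_chain2[OF DERIV_mult_log]) (auto intro!: derivative_eq_intros)
    moreover have "DERIV (\<lambda>t. (1 - t) / 2 * log 2 ((1 - t) / 2)) t :>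
        (log 2 ((1 - t) / 2) + 1 / ln 2) * (- 1 / 2)"
      using t by (intro DERIV_chain2[OF DERIV_mult_log]) (auto intro!: derivative_eq_intros)
    ultimately have "DERIV (\<lambda>t. - ((1 + t) / 2 * log 2 ((1 + t) / 2))
          - (1 - t) / 2 * log 2 ((1 - t) / 2)) t :>
        - ((log 2 ((1 + t) / 2) + 1 / ln 2) * (1 / 2))
          - (log 2 ((1 - t) / 2) + 1 / ln 2) * (- 1 / 2)"
      by (intro DERIV_diff DERIV_minus)
    then have "DERIV h t :> - (log 2 ((1 + t) / 2) - log 2 ((1 - t) / 2)) / 2"
      unfolding h_def[abs_def] by (simp add: algebra_simps diff_divide_distrib)
    moreover have "log 2 ((1 - t) / 2) \<le> log 2 ((1 + t) / 2)"
      using t by simp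
    ultimately show "\<exists>D. DERIV h t :> D \<and> D \<le> 0"
      by (intro exI[of _ "- (log 2 ((1 + t) / 2) - log 2 ((1 - t) / 2)) / 2"]) simp
  qed
qed

section \<open>Parameters of an X state and its vertices\<close>

lemma X_stateE:
  assumes "X_state \<rho>"
  obtains "ent_a \<rho> \<ge> 0" "ent_b \<rho> \<ge> 0" "ent_c \<rho> \<ge> 0" "ent_d \<rho> \<ge> 0"
    "ent_u \<rho> \<ge> 0" "ent_v \<rho> \<ge> 0"
    "ent_a \<rho> + ent_b \<rho> + ent_c \<rho> + ent_d \<rho> = 1"
    "(ent_u \<rho>)\<^sup>2 \<le> ent_a \<rho> * ent_d \<rho>" "(ent_v \<rho>)\<^sup>2 \<le> ent_b \<rho> * ent_c \<rho>"
    "ent_a \<rho> + ent_b \<rho> > 0" "ent_c \<rho> + ent_d \<rho> > 0" "pA \<rho> > 0"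
proof -
  obtain a b c d u v where "\<rho> = x_matrix a b c d u v"
    "a \<ge> 0" "b \<ge> 0" "c \<ge> 0" "d \<ge> 0" "a + b + c + d = 1" "u \<ge> 0" "v \<ge> 0"
    "u\<^sup>2 \<le> a * d" "v\<^sup>2 \<le> b * c" "(a + b) * (c + d) > 0"
    using assms unfolding X_state_def by blast
  then show thesis
    by (intro that) (auto simp: pA_def zero_less_mult_iff)
qed

lemma semiaxes:
  assumes "X_state \<rho>"
  shows "0 \<le> ell2 \<rho>" "ell2 \<rho> \<le> ell1 \<rho>" "0 \<le> ell3 \<rho>"
  using assms by (auto elim!: X_stateE simp: ell1_def ell2_def ell3_def intro!: divide_right_mono)

text \<open>The vertices are the states of B conditioned on the two outcomes of the computational basis
  measurement on A.\<close>

lemma vertices: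
  assumes "X_state \<rho>"
  defines "P \<equiv> (ent_a \<rho> - ent_b \<rho>) / (ent_a \<rho> + ent_b \<rho>)"
    and "Q \<equiv> (ent_c \<rho> - ent_d \<rho>) / (ent_c \<rho> + ent_d \<rho>)"
  shows "z0 \<rho> = (P + Q) / 2" "ell3 \<rho> = \<bar>P - Q\<bar> / 2"
    "zB \<rho> = (ent_a \<rho> + ent_b \<rho>) * P + (ent_c \<rho> + ent_d \<rho>) * Q"
proof -
  let ?s = "ent_a \<rho> + ent_b \<rho>" and ?t = "ent_c \<rho> + ent_d \<rho>"
  have pos: "?s > 0" "?t > 0" "pA \<rho> > 0"
    using assms(1) by (auto elim: X_stateE)
  have PQ: "ent_a \<rho> - ent_b \<rho> = P * ?s" "ent_c \<rho> - ent_d \<rho> = Q * ?t"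
    using pos by (simp_all add: P_def Q_def)
  have "2 * (ent_a \<rho> * ent_c \<rho> - ent_b \<rho> * ent_d \<rho>)
      = (ent_a \<rho> - ent_b \<rho>) * ?t + (ent_c \<rho> - ent_d \<rho>) * ?s"
    by (simp add: algebra_simps)
  also have "\<dots> = (P + Q) * pA \<rho>"
    unfolding PQ pA_def by (simp only: ring_distribs mult_ac)
  finally show "z0 \<rho> = (P + Q) / 2"
    using pos(3) by (simp add: z0_def field_simps)
  have "2 * (ent_a \<rho> * ent_d \<rho> - ent_b \<rho> * ent_c \<rho>)
      = (ent_a \<rho> - ent_b \<rho>) * ?t - (ent_c \<rho> - ent_d \<rho>) * ?s"
    by (simp add: algebra_simps)
  also have "\<dots> = (P - Q) * pA \<rho>"
    unfolding PQ pA_def by (simp only: ring_distribs mult_ac)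
  finally have "(P - Q) / 2 = (ent_a \<rho> * ent_d \<rho> - ent_b \<rho> * ent_c \<rho>) / pA \<rho>"
    using pos(3) by (simp add: field_simps)
  then have "\<bar>(P - Q) / 2\<bar> = ell3 \<rho>"
    using pos by (simp only: ell3_def abs_divide abs_of_pos)
  then show "ell3 \<rho> = \<bar>P - Q\<bar> / 2"
    by simp
  show "zB \<rho> = ?s * P + ?t * Q"
    using pos by (simp add: zB_def P_def Q_def)
qed

text \<open>The state of B is the mixture of the two vertex states, weighted by the diagonal entries
  \<open>s\<close> and \<open>1 - s\<close> of the reduced state of A.\<close>

lemma zB_between:
  assumes "X_state \<rho>"
  shows "zB \<rho> \<in> {zH \<rho>..zG \<rho>}"
proof -
  define s where "s = ent_a \<rho> + ent_b \<rho>"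
  define P where "P = (ent_a \<rho> - ent_b \<rho>) / (ent_a \<rho> + ent_b \<rho>)"
  define Q where "Q = (ent_c \<rho> - ent_d \<rho>) / (ent_c \<rho> + ent_d \<rho>)"
  have s: "0 \<le> s" "0 \<le> 1 - s" "ent_c \<rho> + ent_d \<rho> = 1 - s"
    using assms by (auto elim!: X_stateE simp: s_def)
  then have "zB \<rho> \<in> closed_segment Q P"
    using vertices(3)[OF assms]
    by (auto simp: in_segment P_def Q_def s_def intro!: exI[of _ s])
  then show ?thesis
    using vertices(1,2)[OF assms]
    by (auto simp: zH_def zG_def P_def[symmetric] Q_def[symmetric] closed_segment_eq_real_ivl
        abs_if field_simps split: if_splits)
qed

text \<open>Rescaling the part of A turns the X state into one whose diagonal gives A the weights
  \<open>l\<close> and \<open>1 - l\<close> and gives B the height of the chosen point. Positivity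
  of the rescaled matrix, split into three bounds, then limits \<open>ell1\<close>. This keeps the
  arguments of \<open>h\<close> in the range where it is antitone.\<close>

lemma ellipse_in_unit_disc:
  assumes "X_state \<rho>" "n\<^sup>2 \<le> 1"
  shows "(z0 \<rho> + ell3 \<rho> * n)\<^sup>2 + (ell1 \<rho>)\<^sup>2 * (1 - n\<^sup>2) \<le> 1"
proof -
  define a b c d u v where ent: "a = ent_a \<rho>" "b = ent_b \<rho>" "c = ent_c \<rho>" "d = ent_d \<rho>"
    "u = ent_u \<rho>" "v = ent_v \<rho>"
  note X = X_stateE[OF assms(1), folded ent]
  have nn: "a \<ge> 0" "b \<ge> 0" "c \<ge> 0" "d \<ge> 0" "u \<ge> 0" "v \<ge> 0"
    and uv: "u\<^sup>2 \<le> a * d" "v\<^sup>2 \<le> b * c" and pos: "a + b > 0" "c + d > 0" "pA \<rho> > 0"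
    by (rule X; simp)+
  define P where "P = (a - b) / (a + b)"
  define Q where "Q = (c - d) / (c + d)"
  note V = vertices[OF assms(1), folded ent, folded P_def Q_def]
  \<comment> \<open>As \<open>ell3 \<rho>\<close> is an absolute value, the sign of \<open>n\<close>
    is adjusted so that the height becomes the mixture of \<open>P\<close> and \<open>Q\<close> with
    weights \<open>l\<close> and \<open>1 - l\<close>.\<close>
  define s where "s = (if P \<ge> Q then n else - n)"
  define l where "l = (1 + s) / 2"
  have s: "s\<^sup>2 = n\<^sup>2" "\<bar>s\<bar> \<le> 1"
    using assms(2) by (auto simp: s_def abs_square_le_1)
  then have l: "0 \<le> l" "0 \<le> 1 - l" "4 * (l * (1 - l)) = 1 - n\<^sup>2"
    by (auto simp: l_def s(1)[symmetric] field_simps power2_eq_square)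
  have z: "z0 \<rho> + ell3 \<rho> * n = l * P + (1 - l) * Q"
    by (auto simp: V s_def l_def abs_if field_simps)
  \<comment> \<open>These are the rescaled diagonal entries; \<open>a' + c'\<close> and
    \<open>b' + d'\<close> are the halves of 1 plus and 1 minus the height. The antidiagonal entries
    scale by the square root of \<open>k\<close>, defined below.\<close>
  define a' b' c' d' where n': "a' = l * (a / (a + b))" "b' = l * (b / (a + b))"
    "c' = (1 - l) * (c / (c + d))" "d' = (1 - l) * (d / (c + d))"
  have nn': "a' \<ge> 0" "b' \<ge> 0" "c' \<ge> 0" "d' \<ge> 0"
    using nn l by (simp_all add: n')
  have ab: "a / (a + b) = (1 + P) / 2" "b / (a + b) = (1 - P) / 2"
    "c / (c + d) = (1 + Q) / 2" "d / (c + d) = (1 - Q) / 2"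
    using pos by (auto simp: P_def Q_def field_simps)
  have one_z: "1 - (l * P + (1 - l) * Q)\<^sup>2 = 4 * ((a' + c') * (b' + d'))"
    unfolding n' ab by (simp add: field_simps power2_eq_square)
  define k where "k = l * (1 - l) / pA \<rho>"
  have k: "k \<ge> 0" using l pos by (simp add: k_def)
  have cross: "a' * d' = k * (a * d)" "b' * c' = k * (b * c)"
    using pos by (simp_all add: n' k_def pA_def ent field_simps)
  \<comment> \<open>The target expands into \<open>a' * d'\<close>, \<open>b' * c'\<close> and
    \<open>a' * b' + c' * d'\<close>. The first two dominate the square terms in \<open>u\<close>
    and \<open>v\<close>. For the mixed term, the product of both positivity bounds is regrouped as
    \<open>(a' * b') * (c' * d')\<close>, and the inequality of arithmetic and geometric means
    applies.\<close>
  have "(k * (u * v))\<^sup>2 = k\<^sup>2 * (u\<^sup>2 * v\<^sup>2)"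
    by (simp add: power_mult_distrib)
  also have "\<dots> \<le> k\<^sup>2 * ((a * d) * (b * c))"
    using uv nn by (intro mult_left_mono mult_mono) auto
  also have "\<dots> = (a' * b') * (c' * d')"
    using cross by (simp add: power2_eq_square algebra_simps) (metis mult.assoc mult.left_commute)
  also have "\<dots> \<le> ((a' * b' + c' * d') / 2)\<^sup>2"
    using zero_le_power2[of "a' * b' - c' * d'"] by (simp add: power2_eq_square field_simps)
  finally have "k * (u * v) \<le> (a' * b' + c' * d') / 2"
    by (rule power2_le_imp_le) (simp add: nn')
  moreover have "k * u\<^sup>2 \<le> a' * d'" "k * v\<^sup>2 \<le> b' * c'"
    using uv k by (simp_all add: cross mult_left_mono)
  ultimately have "k * (u + v)\<^sup>2 \<le> (a' + c') * (b' + d')"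
    by (simp add: power2_eq_square algebra_simps)
  moreover have "(ell1 \<rho>)\<^sup>2 * (1 - n\<^sup>2) = 4 * (k * (u + v)\<^sup>2)"
    using pos by (simp add: ell1_def k_def ent power_divide l(3)[symmetric])
  ultimately show ?thesis
    using one_z z by simp
qed

section \<open>Heights and entropies of points of the ellipsoid\<close>

lemma norm_vec3: "norm (X :: real^3) = sqrt ((X$1)\<^sup>2 + (X$2)\<^sup>2 + (X$3)\<^sup>2)"
  by (simp add: norm_vec_def L2_set_def sum_3)

lemma steering_ellipsoidE:
  assumes "X \<in> steering_ellipsoid \<rho>"
  obtains n1 n2 n3 where "X = vector [ell1 \<rho> * n1, ell2 \<rho> * n2, z0 \<rho> + ell3 \<rho> * n3]"
    "n1\<^sup>2 + n2\<^sup>2 + n3\<^sup>2 = 1" "\<bar>n1\<bar> \<le> 1" "\<bar>n3\<bar> \<le> 1"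
proof -
  obtain n1 n2 n3 where n: "X = vector [ell1 \<rho> * n1, ell2 \<rho> * n2, z0 \<rho> + ell3 \<rho> * n3]"
    "n1\<^sup>2 + n2\<^sup>2 + n3\<^sup>2 = 1"
    using assms by (auto simp: steering_ellipsoid_def)
  have "n1\<^sup>2 \<le> 1" "n3\<^sup>2 \<le> 1"
    using n(2) zero_le_power2[of n1] zero_le_power2[of n2] zero_le_power2[of n3] by linarith+
  with n show thesis
    by (intro that[of n1 n2 n3]) (auto simp: abs_square_le_1)
qed

lemma steering_ellipsoid_height:
  assumes "X_state \<rho>" "X \<in> steering_ellipsoid \<rho>"
  shows "X $ 3 \<in> {zH \<rho>..zG \<rho>}"
proof -
  obtain n where n: "X $ 3 = z0 \<rho> + ell3 \<rho> * n" "\<bar>n\<bar> \<le> 1"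
    using steering_ellipsoidE[OF assms(2)] by (metis vector_3(3))
  have "\<bar>ell3 \<rho> * n\<bar> \<le> ell3 \<rho>"
    using n(2) semiaxes[OF assms(1)] by (simp add: abs_mult mult_left_le)
  then show ?thesis
    using n(1) by (auto simp: zH_def zG_def)
qed

lemma entropy_at_ge_horizontal:
  assumes "X_state \<rho>" "X \<in> steering_ellipsoid \<rho>"
  shows "horizontal_avg_entropy \<rho> (X $ 3) \<le> entropy_at X"
proof -
  obtain n1 n2 n3 where X: "X = vector [ell1 \<rho> * n1, ell2 \<rho> * n2, z0 \<rho> + ell3 \<rho> * n3]"
    and n: "n1\<^sup>2 + n2\<^sup>2 + n3\<^sup>2 = 1"
    using assms(2) by (rule steering_ellipsoidE)
  \<comment> \<open>If \<open>ell3 \<rho> = 0\<close>, division by zero gives \<open>m = 0\<close>,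
    in agreement with \<open>half_chord\<close>. Then \<open>m\<close> may differ from
    \<open>n3\<close>, but its square is at most that of \<open>n3\<close>, which only lengthens the
    chord.\<close>
  define m where "m = (X $ 3 - z0 \<rho>) / ell3 \<rho>"
  have m: "X $ 3 = z0 \<rho> + ell3 \<rho> * m" "m\<^sup>2 \<le> n3\<^sup>2"
    by (auto simp: m_def X)
  have n3: "n3\<^sup>2 = 1 - n1\<^sup>2 - n2\<^sup>2"
    using n by simp
  have "n3\<^sup>2 \<le> 1"
    using n by (metis add_increasing zero_le_power2 order_refl sum_power2_ge_zero)
  then have disc: "(X $ 3)\<^sup>2 + (ell1 \<rho>)\<^sup>2 * (1 - m\<^sup>2) \<le> 1"
    using ellipse_in_unit_disc[OF assms(1)] m by simp
  have "(ell1 \<rho>)\<^sup>2 * n1\<^sup>2 + (ell2 \<rho>)\<^sup>2 * n2\<^sup>2 \<le> (ell1 \<rho>)\<^sup>2 * n1\<^sup>2 + (ell1 \<rho>)\<^sup>2 * n2\<^sup>2"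
    using semiaxes[OF assms(1)] by (intro add_left_mono mult_right_mono power_mono) auto
  also have "\<dots> = (ell1 \<rho>)\<^sup>2 * (1 - n3\<^sup>2)"
    by (simp add: n3 algebra_simps)
  also have "\<dots> \<le> (ell1 \<rho>)\<^sup>2 * (1 - m\<^sup>2)"
    using m by (intro mult_left_mono) auto
  finally have "norm X \<le> sqrt ((X $ 3)\<^sup>2 + (ell1 \<rho>)\<^sup>2 * (1 - m\<^sup>2))"
    by (simp add: norm_vec3 X power_mult_distrib)
  then have "h (sqrt ((X $ 3)\<^sup>2 + (ell1 \<rho>)\<^sup>2 * (1 - m\<^sup>2))) \<le> entropy_at X"
    unfolding entropy_at_def using disc by (intro h_antimono) auto
  then show ?thesis
    using horizontal_avg_entropy_eq[OF steering_ellipsoid_height[OF assms]]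
    by (simp add: m_def power_divide)
qed

section \<open>Recovering the parameters from the ellipsoid\<close>

text \<open>\<open>ell1\<close> is the largest first coordinate on the surface, \<open>zG\<close>
  and \<open>zH\<close> are the largest and smallest third coordinates; they are attained at the
  parameters \<open>(1, 0, 0)\<close>, \<open>(0, 0, 1)\<close> and
  \<open>(0, 0, -1)\<close>.\<close>

lemma steering_ellipsoid_extents_mono:
  assumes "X_state \<rho>" "X_state \<sigma>" "steering_ellipsoid \<sigma> \<subseteq> steering_ellipsoid \<rho>"
  shows "ell1 \<sigma> \<le> ell1 \<rho>" "zG \<sigma> \<le> zG \<rho>" "zH \<rho> \<le> zH \<sigma>"
proof -
  have mem: "vector [ell1 \<sigma> * n1, ell2 \<sigma> * n2, z0 \<sigma> + ell3 \<sigma> * n3] \<in> steering_ellipsoid \<rho>"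
    if "n1\<^sup>2 + n2\<^sup>2 + n3\<^sup>2 = 1" for n1 n2 n3
  proof -
    have "vector [ell1 \<sigma> * n1, ell2 \<sigma> * n2, z0 \<sigma> + ell3 \<sigma> * n3] \<in> steering_ellipsoid \<sigma>"
      unfolding steering_ellipsoid_def using that by blast
    then show ?thesis
      using assms(3) by blast
  qed
  obtain n where "ell1 \<sigma> = ell1 \<rho> * n" "\<bar>n\<bar> \<le> 1"
    using steering_ellipsoidE[OF mem[of 1 0 0]] by (force simp: vec_eq_iff forall_3)
  then show "ell1 \<sigma> \<le> ell1 \<rho>"
    using semiaxes[OF assms(1)] by (auto intro!: mult_left_le)
  show "zG \<sigma> \<le> zG \<rho>" "zH \<rho> \<le> zH \<sigma>"
    using steering_ellipsoid_height[OF assms(1) mem[of 0 0 1]]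
      steering_ellipsoid_height[OF assms(1) mem[of 0 0 "-1"]]
    by (auto simp: zG_def[of \<sigma>] zH_def[of \<sigma>])
qed

text \<open>The types quantify over all states with a given ellipsoid, while convexity or concavity
  is assumed for one of them; this transfers the assumption. \<open>z0\<close> and
  \<open>ell3\<close> are half the sum and half the difference of \<open>zG\<close> and
  \<open>zH\<close>.\<close>

lemma steering_ellipsoid_determines:
  assumes "X_state \<rho>" "X_state \<sigma>" "steering_ellipsoid \<sigma> = steering_ellipsoid \<rho>"
  shows "ell1 \<sigma> = ell1 \<rho>" "ell3 \<sigma> = ell3 \<rho>" "zG \<sigma> = zG \<rho>" "zH \<sigma> = zH \<rho>"
    "horizontal_avg_entropy \<sigma> = horizontal_avg_entropy \<rho>"
proof -
  show eq: "ell1 \<sigma> = ell1 \<rho>" "zG \<sigma> = zG \<rho>" "zH \<sigma> = zH \<rho>"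
    using steering_ellipsoid_extents_mono[OF assms(1,2)]
      steering_ellipsoid_extents_mono[OF assms(2,1)] assms(3) by (auto intro: antisym)
  then have "z0 \<sigma> = z0 \<rho>" and l3: "ell3 \<sigma> = ell3 \<rho>"
    unfolding zG_def zH_def by linarith+
  with eq show "horizontal_avg_entropy \<sigma> = horizontal_avg_entropy \<rho>"
    by (simp add: horizontal_avg_entropy_def horizontal_decomp_def half_chord_def fun_eq_iff)
  show "ell3 \<sigma> = ell3 \<rho>" by (fact l3)
qed

section \<open>Ensembles and the two candidate decompositions\<close>

text \<open>Jensen's inequality for ensembles. Summing over positions of the list keeps repeated
  entries apart; the list is nonempty because its weights sum to 1.\<close>

lemma convex_on_sum_list:
  fixes f :: "real \<Rightarrow> real"
  assumes "convex_on C f" "\<forall>(p, X)\<in>set D. 0 \<le> p \<and> g X \<in> C" "(\<Sum>(p, X)\<leftarrow>D. p) = 1"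
  shows "f (\<Sum>(p, X)\<leftarrow>D. p * g X) \<le> (\<Sum>(p, X)\<leftarrow>D. p * f (g X))"
proof -
  have "f (\<Sum>i\<in>{0..<length D}. fst (D ! i) *\<^sub>R g (snd (D ! i)))
      \<le> (\<Sum>i\<in>{0..<length D}. fst (D ! i) * f (g (snd (D ! i))))"
  proof (rule convex_on_sum[OF _ _ assms(1)])
    show "{0..<length D} \<noteq> {}"
      using assms(3) by auto
    show "(\<Sum>i\<in>{0..<length D}. fst (D ! i)) = 1"
      using assms(3) by (simp add: sum_list_sum_nth case_prod_beta)
    show "0 \<le> fst (D ! i)" "g (snd (D ! i)) \<in> C" if "i \<in> {0..<length D}" for i
      using assms(2) that by (auto simp: case_prod_beta)
  qed simp
  then show ?thesis
    by (simp add: sum_list_sum_nth case_prod_beta)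
qed

lemma sum_list_scaleR_nth:
  "(\<Sum>(p, X)\<leftarrow>D. p *\<^sub>R X) $ i = (\<Sum>(p, X)\<leftarrow>D. p * (X $ i))" for D :: "(real \<times> (real^'n)) list"
  by (induction D) (auto simp: case_prod_beta)

lemma avg_entropy_ge_horizontal:
  assumes "X_state \<rho>" "decomposition \<rho> D"
  shows "(\<Sum>(p, X)\<leftarrow>D. p * horizontal_avg_entropy \<rho> (X $ 3)) \<le> avg_entropy D"
  unfolding avg_entropy_def
  using assms entropy_at_ge_horizontal
  by (intro sum_list_mono) (auto simp: decomposition_def intro!: mult_left_mono)

lemma decomposition_mean_height:
  assumes "decomposition \<rho> D"
  shows "(\<Sum>(p, X)\<leftarrow>D. p * (X $ 3)) = zB \<rho>"
  using assms sum_list_scaleR_nth[of D 3] by (simp add: decomposition_def bloch_B_def)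

lemma decomposition_horizontal:
  assumes "X_state \<rho>"
  shows "decomposition \<rho> (horizontal_decomp \<rho> (zB \<rho>))"
proof -
  let ?z = "zB \<rho>"
  define m where "m = (?z - z0 \<rho>) / ell3 \<rho>"
  have z: "\<bar>?z - z0 \<rho>\<bar> \<le> ell3 \<rho>"
    using zB_between[OF assms] by (auto simp: zH_def zG_def)
  then have m: "?z = z0 \<rho> + ell3 \<rho> * m" "m\<^sup>2 \<le> 1"
    by (auto simp: m_def abs_square_le_1 divide_le_eq_1)
  \<comment> \<open>The end points of the chord have the parameters \<open>(n, 0, m)\<close> with
    \<open>n\<close> one of the two square roots of \<open>1 - m\<^sup>2\<close>.\<close>
  have mem: "vector [ell1 \<rho> * n, 0, ?z] \<in> steering_ellipsoid \<rho>" if "n\<^sup>2 = 1 - m\<^sup>2" for n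
    unfolding steering_ellipsoid_def
    by (rule CollectI, rule exI[of _ n], rule exI[of _ 0], rule exI[of _ m]) (use m(1) that in simp)
  have half: "half_chord \<rho> ?z = ell1 \<rho> * sqrt (1 - m\<^sup>2)"
    by (simp add: half_chord_def m_def power_divide)
  show ?thesis
    using mem[of "sqrt (1 - m\<^sup>2)"] mem[of "- sqrt (1 - m\<^sup>2)"] m(2)
    by (simp add: decomposition_def horizontal_decomp_def half bloch_B_def vec_eq_iff forall_3)
qed

lemma decomposition_vertical:
  assumes "X_state \<rho>" "\<not> (ell3 \<rho> = 0 \<and> ell1 \<rho> > 0)"
  shows "decomposition \<rho> (vertical_decomp \<rho>)"
proof -
  define w where "w = (zB \<rho> - zH \<rho>) / (zG \<rho> - zH \<rho>)"
  have z: "zH \<rho> \<le> zB \<rho>" "zB \<rho> \<le> zG \<rho>"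
    using zB_between[OF assms(1)] by auto
  \<comment> \<open>If the vertices coincide, \<open>w = 0\<close> by division by zero, and both
    sides vanish since \<open>zB \<rho> = zH \<rho>\<close>.\<close>
  then have "w * (zG \<rho> - zH \<rho>) = zB \<rho> - zH \<rho>"
    by (auto simp: w_def)
  then have "zB \<rho> = w * zG \<rho> + (1 - w) * zH \<rho>"
    by (simp add: algebra_simps)
  moreover have "0 \<le> w" "0 \<le> 1 - w"
    using z by (auto simp: w_def divide_le_eq_1)
  ultimately have w: "0 \<le> w" "0 \<le> 1 - w" "zB \<rho> = w * zG \<rho> + (1 - w) * zH \<rho>"
    by auto
  have mem: "vector [0, 0, z0 \<rho> + ell3 \<rho> * n] \<in> steering_ellipsoid \<rho>" if "n\<^sup>2 = 1" for n
    unfolding steering_ellipsoid_def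
    by (rule CollectI, rule exI[of _ 0], rule exI[of _ 0], rule exI[of _ n]) (use that in simp)
  show ?thesis
    unfolding vertical_decomp_def Let_def w_def[symmetric]
    using mem[of 1] mem[of "-1"] w
    by (simp add: decomposition_def bloch_B_def vec_eq_iff forall_3
        zG_def[symmetric] zH_def[symmetric])
qed

section \<open>Optimality of the two decompositions\<close>

lemma optimal_horizontal:
  assumes "X_state \<rho>" "convex_on {zH \<rho>..zG \<rho>} (horizontal_avg_entropy \<rho>)"
  shows "optimal \<rho> (horizontal_decomp \<rho> (zB \<rho>))"
  unfolding optimal_def
proof (intro conjI allI impI)
  fix D assume D: "decomposition \<rho> D"
  have "horizontal_avg_entropy \<rho> (\<Sum>(p, X)\<leftarrow>D. p * (X $ 3))
      \<le> (\<Sum>(p, X)\<leftarrow>D. p * horizontal_avg_entropy \<rho> (X $ 3))"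
    using D steering_ellipsoid_height[OF assms(1)]
    by (intro convex_on_sum_list[OF assms(2)]) (fastforce simp: decomposition_def)+
  also have "\<dots> \<le> avg_entropy D"
    by (rule avg_entropy_ge_horizontal[OF assms(1) D])
  finally show "avg_entropy (horizontal_decomp \<rho> (zB \<rho>)) \<le> avg_entropy D"
    by (simp add: decomposition_mean_height[OF D] horizontal_avg_entropy_def)
qed (rule decomposition_horizontal[OF assms(1)])

text \<open>The chord through a vertex shrinks to a point: for \<open>ell3 \<rho> \<noteq> 0\<close>
  the root in \<open>half_chord\<close> vanishes, and otherwise \<open>ell1 \<rho> = 0\<close>. In
  the excluded case \<open>half_chord\<close> would equal \<open>ell1 \<rho> > 0\<close>.\<close>

lemma horizontal_avg_entropy_vertex:
  assumes "X_state \<rho>" "\<not> (ell3 \<rho> = 0 \<and> ell1 \<rho> > 0)" "z = zG \<rho> \<or> z = zH \<rho>"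
  shows "horizontal_avg_entropy \<rho> z = entropy_at (vector [0, 0, z])"
proof -
  have "half_chord \<rho> z = 0"
    using assms semiaxes[OF assms(1)] by (auto simp: half_chord_def zG_def zH_def)
  then show ?thesis
    by (simp add: horizontal_avg_entropy_def avg_entropy_def horizontal_decomp_def)
qed

lemma optimal_vertical:
  assumes "X_state \<rho>" "concave_on {zH \<rho>..zG \<rho>} (horizontal_avg_entropy \<rho>)"
    "\<not> (ell3 \<rho> = 0 \<and> ell1 \<rho> > 0)"
  shows "optimal \<rho> (vertical_decomp \<rho>)"
  unfolding optimal_def
proof (intro conjI allI impI)
  fix D assume D: "decomposition \<rho> D"
  let ?f = "horizontal_avg_entropy \<rho>"
  define k where "k = (?f (zG \<rho>) - ?f (zH \<rho>)) / (zG \<rho> - zH \<rho>)"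
  \<comment> \<open>\<open>L\<close> is the affine function agreeing with \<open>?f\<close> at both
    vertices; it is constant when they coincide, as then \<open>k = 0\<close>.\<close>
  define L where "L z = ?f (zH \<rho>) + k * (z - zH \<rho>)" for z
  have chord: "L z \<le> ?f z" if z: "z \<in> {zH \<rho>..zG \<rho>}" for z
  proof (cases "zH \<rho> = zG \<rho>")
    case True
    then show ?thesis using z by (simp add: L_def)
  next
    case False
    have "convex_on {zH \<rho>..zG \<rho>} (\<lambda>x. - ?f x)"
      using assms(2) by (simp add: concave_on_def)
    from convex_onD_Icc'[OF this z] show ?thesis
      using z by (simp add: L_def k_def diff_divide_distrib algebra_simps)
  qed
  have "avg_entropy (vertical_decomp \<rho>) = L (zB \<rho>)"
    using horizontal_avg_entropy_vertex[OF assms(1,3)]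
    by (simp add: avg_entropy_def vertical_decomp_def Let_def L_def k_def algebra_simps
        diff_divide_distrib)
  \<comment> \<open>The factor 1 in the constant term is written as the total weight, so that the
    next identity is linear in the ensemble and follows by induction on \<open>D\<close> without
    normalisation.\<close>
  also have "\<dots> = (?f (zH \<rho>) - k * zH \<rho>) * (\<Sum>(p, X)\<leftarrow>D. p) + k * (\<Sum>(p, X)\<leftarrow>D. p * (X $ 3))"
    using D unfolding decomposition_mean_height[OF D]
    by (simp add: L_def decomposition_def algebra_simps)
  also have "\<dots> = (\<Sum>(p, X)\<leftarrow>D. p * L (X $ 3))"
    unfolding L_def by (induction D) (auto simp: algebra_simps)
  also have "\<dots> \<le> (\<Sum>(p, X)\<leftarrow>D. p * ?f (X $ 3))"
    using D steering_ellipsoid_height[OF assms(1)] chord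
    by (intro sum_list_mono) (fastforce simp: decomposition_def intro!: mult_left_mono)
  also have "\<dots> \<le> avg_entropy D"
    by (rule avg_entropy_ge_horizontal[OF assms(1) D])
  finally show "avg_entropy (vertical_decomp \<rho>) \<le> avg_entropy D" .
qed (rule decomposition_vertical[OF assms(1,3)])

theorem proposition2:
  fixes E :: "(real^3) set" and \<rho> :: "real^4^4"
  assumes "X_state \<rho>" and "E = steering_ellipsoid \<rho>"
  shows "(convex_on {zH \<rho>..zG \<rho>} (horizontal_avg_entropy \<rho>) \<longrightarrow> type_horizontal E) \<and>
    (concave_on {zH \<rho>..zG \<rho>} (horizontal_avg_entropy \<rho>) \<longrightarrow>
       \<not> (ell3 \<rho> = 0 \<and> ell1 \<rho> > 0) \<longrightarrow> type_vertical E)"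
  unfolding type_horizontal_def type_vertical_def assms(2)
  using optimal_horizontal optimal_vertical steering_ellipsoid_determines[OF assms(1)]
  by metis

end
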